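(* Let $T>0$, $\alpha>0$, $\beta>0$, $\gamma>0$, and $Q_T=(0,1)\times(0,T)$. Let $u,v$ be real-valued functions on $\bar Q_T=[0,1]\times[0,T]$ such that $u,u_t,u_x,u_{xx},v,v_t,v_x$ exist and are continuous on $\bar Q_T$, and suppose that $(u,v)$ satisfies $$v_t=\beta\, v_x u_x-\gamma(\alpha-|u_x|)\,v,\qquad u_t=\gamma(\alpha-|u_x|)\,v\qquad\text{in } Q_T,$$ with initial conditions $$u(x,0)=u_o(x)\ge 0,\qquad v(x,0)=v_o(x)\ge 0,\qquad |u_{ox}(x)|\le\alpha,\qquad x\in[0,1],$$ and boundary conditions $$u(0,t)=u(1,t)=0,\qquad v(0,t)=v(1,t)=0,\qquad t\in(0,T).$$ Then the maximum value of $u+v$ over $[0,1]\times[0,T]$ is attained at $t=0$, that is, $$\max_{(x,t)\in[0,1]\times[0,T]}\bigl(u(x,t)+v(x,t)\bigr)=\max_{x\in[0,1]}\bigl(u_o(x)+v_o(x)\bigr).$$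
   Context: The system models one-dimensional granular matter formation without an external source: $u(x,t)$ is the height of the standing layer and $v(x,t)$ the height of the rolling layer at position $x$ and time $t$; $\alpha$ is the critical slope and $\beta,\gamma$ are positive parameters. Subscripts $t$, $x$, $xx$ denote partial derivatives (one-sided at the boundary of $\bar Q_T$), and $u_{ox}$ denotes the derivative of the initial profile $u_o$. *)

theory Defs
  imports "HOL-Analysis.Analysis"
begin

definition Q :: "real \<Rightarrow> (real \<times> real) set" where
  "Q T = {0<..<1} \<times> {0<..<T}"

definition Qbar :: "real \<Rightarrow> (real \<times> real) set" where
  "Qbar T = {0..1} \<times> {0..T}"

text \<open>Partial derivatives on the closed rectangle. Taking the derivative within the closed
  interval makes it one-sided at the boundary, and it depends only on the values of the function
  on the rectangle. Derivatives within an interval of positive length are unique, so \<open>fx\<close> and \<open>ft\<close>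
  are determined on \<open>Qbar T\<close> by \<open>f\<close>.\<close>

definition has_partial_x ::
  "real \<Rightarrow> (real \<Rightarrow> real \<Rightarrow> real) \<Rightarrow> (real \<Rightarrow> real \<Rightarrow> real) \<Rightarrow> bool" where
  "has_partial_x T f fx \<longleftrightarrow>
     (\<forall>(x, t) \<in> Qbar T. ((\<lambda>y. f y t) has_real_derivative fx x t) (at x within {0..1}))"

definition has_partial_t ::
  "real \<Rightarrow> (real \<Rightarrow> real \<Rightarrow> real) \<Rightarrow> (real \<Rightarrow> real \<Rightarrow> real) \<Rightarrow> bool" where
  "has_partial_t T f ft \<longleftrightarrow>
     (\<forall>(x, t) \<in> Qbar T. ((\<lambda>s. f x s) has_real_derivative ft x t) (at t within {0..T}))"

definition continuous_Qbar :: "real \<Rightarrow> (real \<Rightarrow> real \<Rightarrow> real) \<Rightarrow> bool" where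
  "continuous_Qbar T f \<longleftrightarrow> continuous_on (Qbar T) (\<lambda>(x, t). f x t)"

end

theory Submission
  imports Defs
begin

text \<open>The sum \<open>w = u + v\<close> does not see the exchange term \<open>\<gamma> (\<alpha> - \<bar>u\<^sub>x\<bar>) v\<close>, which the two layers
  hand to each other with opposite signs, so it satisfies \<open>w\<^sub>t = \<beta> v\<^sub>x u\<^sub>x\<close>. Where \<open>w\<^sub>x = 0\<close>, that is
  \<open>v\<^sub>x = - u\<^sub>x\<close>, this gives \<open>w\<^sub>t = - \<beta> u\<^sub>x\<^sup>2 \<le> 0\<close>: the sum cannot grow at a spatial critical point. This
  sign condition alone yields a maximum principle (\<open>max_principle_critical_points\<close>), so that \<open>w\<close> is
  bounded by any upper bound of its values at \<open>t = 0\<close> and on the lateral sides. On the sides \<open>w\<close>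
  vanishes, and the initial profile is nonnegative; hence the initial maximum is such a bound.\<close>

lemma has_partial_x_add:
  assumes "has_partial_x T f fx" "has_partial_x T g gx"
  shows "has_partial_x T (\<lambda>x t. f x t + g x t) (\<lambda>x t. fx x t + gx x t)"
  using assms unfolding has_partial_x_def by (auto intro!: DERIV_add)

lemma has_partial_t_add:
  assumes "has_partial_t T f ft" "has_partial_t T g gt"
  shows "has_partial_t T (\<lambda>x t. f x t + g x t) (\<lambda>x t. ft x t + gt x t)"
  using assms unfolding has_partial_t_def by (auto intro!: DERIV_add)

lemma continuous_Qbar_add:
  assumes "continuous_Qbar T f" "continuous_Qbar T g"
  shows "continuous_Qbar T (\<lambda>x t. f x t + g x t)"
  using assms unfolding continuous_Qbar_def case_prod_beta by (rule continuous_on_add)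

text \<open>For every \<open>\<epsilon> > 0\<close>, the penalised function \<open>w - \<epsilon> t\<close> has no maximum at a point with
  \<open>0 < x < 1\<close> and \<open>0 < t \<le> \<tau>\<close>: there \<open>w\<^sub>x = 0\<close>, so \<open>w - \<epsilon> t\<close> is strictly decreasing in time and was
  larger just before. The penalty is needed because the hypothesis only gives \<open>w\<^sub>t \<le> 0\<close>.
  Choosing \<open>\<tau> < T\<close> keeps the maximum point in \<open>Q T\<close>, where the sign condition is known.\<close>

lemma penalised_max_principle:
  fixes w wx wt :: "real \<Rightarrow> real \<Rightarrow> real"
  assumes cont: "continuous_Qbar T w"
    and dx: "has_partial_x T w wx" and dt: "has_partial_t T w wt"
    and crit: "\<And>x t. (x, t) \<in> Q T \<Longrightarrow> wx x t = 0 \<Longrightarrow> wt x t \<le> 0"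
    and init: "\<And>x. x \<in> {0..1} \<Longrightarrow> w x 0 \<le> M"
    and sides: "\<And>t. t \<in> {0<..<T} \<Longrightarrow> w 0 t \<le> M \<and> w 1 t \<le> M"
    and "0 \<le> \<tau>" "\<tau> < T" and "0 < \<epsilon>" and x: "x \<in> {0..1}"
  shows "w x \<tau> \<le> M + \<epsilon> * \<tau>"
proof -
  define K :: "(real \<times> real) set" where "K = {0..1} \<times> {0..\<tau>}"
  have "K \<subseteq> Qbar T"
    using \<open>\<tau> < T\<close> by (auto simp: K_def Qbar_def)
  then have "continuous_on K (\<lambda>p. w (fst p) (snd p))"
    using cont by (auto simp: continuous_Qbar_def case_prod_beta intro: continuous_on_subset)
  then have "continuous_on K (\<lambda>p. w (fst p) (snd p) - \<epsilon> * snd p)"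
    by (intro continuous_intros)
  moreover have "compact K" "K \<noteq> {}"
    using \<open>0 \<le> \<tau>\<close> by (auto simp: K_def intro: compact_Times)
  ultimately have "\<exists>p\<in>K. \<forall>q\<in>K. w (fst q) (snd q) - \<epsilon> * snd q \<le> w (fst p) (snd p) - \<epsilon> * snd p"
    by (intro continuous_attains_sup)
  then obtain p where p: "p \<in> K"
    "\<And>q. q \<in> K \<Longrightarrow> w (fst q) (snd q) - \<epsilon> * snd q \<le> w (fst p) (snd p) - \<epsilon> * snd p"
    by blast
  define a s where "a = fst p" and "s = snd p"
  have as: "0 \<le> a" "a \<le> 1" "0 \<le> s" "s \<le> \<tau>"
    using p(1) by (auto simp: K_def a_def s_def)
  have max: "w y r - \<epsilon> * r \<le> w a s - \<epsilon> * s" if "0 \<le> y" "y \<le> 1" "0 \<le> r" "r \<le> \<tau>" for y r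
    using p(2)[of "(y, r)"] that by (simp add: K_def a_def s_def)
  have "w a s - \<epsilon> * s \<le> M"
  proof (cases "s = 0 \<or> a = 0 \<or> a = 1")
    case True
    have "0 \<le> \<epsilon> * s"
      using \<open>0 < \<epsilon>\<close> as by simp
    moreover have "w a s \<le> M"
      using True init[of a] sides[of s] as \<open>\<tau> < T\<close> by (cases "s = 0") auto
    ultimately show ?thesis by simp
  next
    case False
    then have inner: "0 < a" "a < 1" "0 < s" "s < T"
      using as \<open>\<tau> < T\<close> by auto
    then have "((\<lambda>y. w y s) has_real_derivative wx a s) (at a within {0..1})"
      "((\<lambda>r. w a r) has_real_derivative wt a s) (at s within {0..T})"
      using dx dt by (auto simp: has_partial_x_def has_partial_t_def Qbar_def)
    then have Dx: "((\<lambda>y. w y s) has_real_derivative wx a s) (at a)"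
      and Dt: "((\<lambda>r. w a r) has_real_derivative wt a s) (at s)"
      using inner by (simp_all add: at_within_Icc_at)
    have "wx a s = 0"
    proof (rule DERIV_local_max[OF Dx])
      show "0 < min a (1 - a)"
        using inner by simp
      show "\<forall>y. \<bar>a - y\<bar> < min a (1 - a) \<longrightarrow> w y s \<le> w a s"
        using max[of _ s] as by auto
    qed
    then have "wt a s - \<epsilon> < 0"
      using crit[of a s] inner \<open>0 < \<epsilon>\<close> by (force simp: Q_def)
    moreover have "((\<lambda>r. w a r - \<epsilon> * r) has_real_derivative wt a s - \<epsilon>) (at s)"
      by (auto intro!: derivative_eq_intros Dt)
    ultimately obtain d where "0 < d"
      and d: "\<And>h. 0 < h \<Longrightarrow> h < d \<Longrightarrow> w a s - \<epsilon> * s < w a (s - h) - \<epsilon> * (s - h)"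
      using DERIV_neg_dec_left by blast
    define h where "h = min (d / 2) s"
    have "0 < h" "h < d" "h \<le> s"
      using \<open>0 < d\<close> inner by (auto simp: h_def)
    then have False
      using d[of h] max[of a "s - h"] as by auto
    then show ?thesis ..
  qed
  then show ?thesis
    using max[of x \<tau>] x \<open>0 \<le> \<tau>\<close> by auto
qed

text \<open>A function that does not increase in time at its spatial critical points stays below its
  values on the bottom and the lateral sides of the rectangle. Letting \<open>\<epsilon>\<close> tend to \<open>0\<close> in the
  penalised estimate covers all times before \<open>T\<close>; the final time follows by continuity.\<close>

lemma max_principle_critical_points:
  fixes w wx wt :: "real \<Rightarrow> real \<Rightarrow> real"
  assumes "T > 0"
    and cont: "continuous_Qbar T w"
    and dx: "has_partial_x T w wx" and dt: "has_partial_t T w wt"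
    and crit: "\<And>x t. (x, t) \<in> Q T \<Longrightarrow> wx x t = 0 \<Longrightarrow> wt x t \<le> 0"
    and init: "\<And>x. x \<in> {0..1} \<Longrightarrow> w x 0 \<le> M"
    and sides: "\<And>t. t \<in> {0<..<T} \<Longrightarrow> w 0 t \<le> M \<and> w 1 t \<le> M"
    and xt: "(x, t) \<in> Qbar T"
  shows "w x t \<le> M"
proof -
  have x: "x \<in> {0..1}" and t: "t \<in> {0..T}"
    using xt by (auto simp: Qbar_def)
  have before: "w x r \<le> M" if r: "r \<in> {0..<T}" for r
  proof (rule field_le_epsilon)
    fix e :: real assume "0 < e"
    have "w x r \<le> M + e / T * r"
      using penalised_max_principle[OF cont dx dt crit init sides, of r "e / T" x]
        r x \<open>0 < e\<close> \<open>T > 0\<close> by simp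
    also have "e / T * r \<le> e"
      using r \<open>0 < e\<close> \<open>T > 0\<close> by (simp add: field_simps)
    finally show "w x r \<le> M + e" by simp
  qed
  have "continuous_on {0..T} (w x)"
    using dt x unfolding has_partial_t_def Qbar_def
    by (intro DERIV_continuous_on[where D = "wt x"]) auto
  then have "continuous_on (closure {0..<T}) (w x)"
    using \<open>T > 0\<close> by simp
  moreover have "t \<in> closure {0..<T}"
    using t \<open>T > 0\<close> by simp
  ultimately show ?thesis
    using before by (auto intro: continuous_le_on_closure)
qed

theorem proposition2p1:
  fixes T \<alpha> \<beta> \<gamma> :: real
    and u u\<^sub>t u\<^sub>x u\<^sub>x\<^sub>x v v\<^sub>t v\<^sub>x :: "real \<Rightarrow> real \<Rightarrow> real"
    and u\<^sub>o u\<^sub>o\<^sub>x v\<^sub>o :: "real \<Rightarrow> real"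
  assumes "T > 0" "\<alpha> > 0" "\<beta> > 0" "\<gamma> > 0"
    and "has_partial_t T u u\<^sub>t" "has_partial_x T u u\<^sub>x" "has_partial_x T u\<^sub>x u\<^sub>x\<^sub>x"
    and "has_partial_t T v v\<^sub>t" "has_partial_x T v v\<^sub>x"
    and "continuous_Qbar T u" "continuous_Qbar T u\<^sub>t" "continuous_Qbar T u\<^sub>x"
      "continuous_Qbar T u\<^sub>x\<^sub>x"
    and "continuous_Qbar T v" "continuous_Qbar T v\<^sub>t" "continuous_Qbar T v\<^sub>x"
    and "\<And>x t. (x, t) \<in> Q T \<Longrightarrow>
      v\<^sub>t x t = \<beta> * v\<^sub>x x t * u\<^sub>x x t - \<gamma> * (\<alpha> - \<bar>u\<^sub>x x t\<bar>) * v x t"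
    and "\<And>x t. (x, t) \<in> Q T \<Longrightarrow> u\<^sub>t x t = \<gamma> * (\<alpha> - \<bar>u\<^sub>x x t\<bar>) * v x t"
    and "\<And>x. x \<in> {0..1} \<Longrightarrow> u x 0 = u\<^sub>o x \<and> u\<^sub>o x \<ge> 0"
    and "\<And>x. x \<in> {0..1} \<Longrightarrow> v x 0 = v\<^sub>o x \<and> v\<^sub>o x \<ge> 0"
    and "\<And>x. x \<in> {0..1} \<Longrightarrow> (u\<^sub>o has_real_derivative u\<^sub>o\<^sub>x x) (at x within {0..1})"
    and "\<And>x. x \<in> {0..1} \<Longrightarrow> \<bar>u\<^sub>o\<^sub>x x\<bar> \<le> \<alpha>"
    and "\<And>t. t \<in> {0<..<T} \<Longrightarrow> u 0 t = 0 \<and> u 1 t = 0"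
    and "\<And>t. t \<in> {0<..<T} \<Longrightarrow> v 0 t = 0 \<and> v 1 t = 0"
  shows "(\<exists>\<xi>\<in>{0..1}.
            is_arg_max (\<lambda>(x, t). u x t + v x t) (\<lambda>p. p \<in> Qbar T) (\<xi>, 0) \<and>
            is_arg_max (\<lambda>x. u\<^sub>o x + v\<^sub>o x) (\<lambda>x. x \<in> {0..1}) \<xi>) \<and>
         (SUP (x, t)\<in>Qbar T. u x t + v x t) = (SUP x\<in>{0..1}. u\<^sub>o x + v\<^sub>o x)"
proof -
  note partials = assms(5-9) and conts = assms(10-16) and v_eq = assms(17) and u_eq = assms(18)
    and u_init = assms(19) and v_init = assms(20) and u_side = assms(23) and v_side = assms(24)
  define w where "w = (\<lambda>x t. u x t + v x t)"
  have cont: "continuous_Qbar T w"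
    and dx: "has_partial_x T w (\<lambda>x t. u\<^sub>x x t + v\<^sub>x x t)"
    and dt: "has_partial_t T w (\<lambda>x t. u\<^sub>t x t + v\<^sub>t x t)"
    unfolding w_def
    by (intro continuous_Qbar_add has_partial_x_add has_partial_t_add partials conts)+
  have init: "w x 0 = u\<^sub>o x + v\<^sub>o x" "0 \<le> w x 0" if "x \<in> {0..1}" for x
    using u_init[OF that] v_init[OF that] by (auto simp: w_def)
  have "continuous_on {0..1} (\<lambda>x. w x 0)"
    using dx \<open>T > 0\<close> unfolding has_partial_x_def Qbar_def
    by (intro DERIV_continuous_on[where D = "\<lambda>x. u\<^sub>x x 0 + v\<^sub>x x 0"]) auto
  then obtain \<xi> where \<xi>: "\<xi> \<in> {0..1}" and "\<And>x. x \<in> {0..1} \<Longrightarrow> w x 0 \<le> w \<xi> 0"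
    using continuous_attains_sup[of "{0..1::real}" "\<lambda>x. w x 0"] by auto
  note init_max = this(2)
  have crit: "u\<^sub>t x t + v\<^sub>t x t \<le> 0" if "(x, t) \<in> Q T" "u\<^sub>x x t + v\<^sub>x x t = 0" for x t
  proof -
    have "v\<^sub>x x t = - u\<^sub>x x t"
      using that(2) by simp
    then have "u\<^sub>t x t + v\<^sub>t x t = - (\<beta> * (u\<^sub>x x t * u\<^sub>x x t))"
      using u_eq[OF that(1)] v_eq[OF that(1)] by simp
    then show ?thesis
      using \<open>\<beta> > 0\<close> by simp
  qed
  have sides: "w 0 t \<le> w \<xi> 0 \<and> w 1 t \<le> w \<xi> 0" if "t \<in> {0<..<T}" for t
    using u_side[OF that] v_side[OF that] init(2)[OF \<xi>] by (simp add: w_def)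
  have bound: "w x t \<le> w \<xi> 0" if "(x, t) \<in> Qbar T" for x t
    using max_principle_critical_points[OF \<open>T > 0\<close> cont dx dt crit init_max sides that] .
  have \<xi>0: "(\<xi>, 0) \<in> Qbar T"
    using \<xi> \<open>T > 0\<close> by (simp add: Qbar_def)
  have "(SUP (x, t)\<in>Qbar T. w x t) = w \<xi> 0"
    using \<xi>0 bound by (intro cSup_eq_maximum) (force simp: image_iff)+
  moreover have "(SUP x\<in>{0..1}. u\<^sub>o x + v\<^sub>o x) = w \<xi> 0"
    using \<xi> init(1) init_max by (intro cSup_eq_maximum) (force simp: image_iff)+
  moreover have "is_arg_max (\<lambda>(x, t). w x t) (\<lambda>p. p \<in> Qbar T) (\<xi>, 0)"
    using \<xi>0 bound by (auto simp: is_arg_max_linorder)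
  moreover have "is_arg_max (\<lambda>x. u\<^sub>o x + v\<^sub>o x) (\<lambda>x. x \<in> {0..1}) \<xi>"
    using \<xi> init_max by (simp add: is_arg_max_linorder flip: init(1))
  ultimately show ?thesis
    using \<xi> unfolding w_def by auto
qed

end
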